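(* Suppose the evaluation distribution $F$ is regular, i.e. $\lambda\mapsto\lambda\bar F^{-1}(\lambda/\Lambda)$ is a continuous concave function on $[0,\Lambda]$. When $\bar F(\mathcal C_s)>0$ and $\mathcal C_s\le\mathcal C_q$, if $$\bar F\left(\frac{\gamma_m}{\gamma_{m+1}}\mathcal C_s+\frac{\gamma_{m+1}-\gamma_m}{\gamma_{m+1}}\mathcal C_q\right)=0,$$ then $\dfrac{g_C^*}{g^*}\ge\dfrac{15}{19}$.
   Context: Model: a Markovian queue with $m$ servers, capacity $N$, maximal arrival rate $\Lambda$, service rate $\mu$, abandonment rates $\theta_s$ (in service) and $\theta_q$ (waiting), holding cost $c_h$, abandonment costs $c_s$ (in service) and $c_q$ (waiting). The parameters are integers $1\le m\le N<\infty$ and reals $\Lambda>0$, $\mu>0$, $\theta_q>0$, $\theta_s\ge 0$, $c_h,c_q,c_s\ge 0$, $0\le a<b<\infty$. $F$ is a continuous cumulative distribution function supported on $[a,b]$ ($F(a)=0$, $F(b)=1$) with a positive density on $[a,b]$; $\bar F=1-F$, and for $y\in[0,1]$, $\bar F^{-1}(y)=\inf\{x\in[a,b]:\bar F(x)\le y\}$. For integers $n\ge0$: $\gamma_n=\min\{n,m\}(\mu+\theta_s)+\max\{n-m,0\}\theta_q$ and $r_n(\lambda)=\lambda\bar F^{-1}(\lambda/\Lambda)-nc_h-\min\{n,m\}c_s\theta_s-\max\{n-m,0\}c_q\theta_q$. Set $\mathcal C_s=\frac{c_h+c_s\theta_s}{\mu+\theta_s}$, $\mathcal C_q=\frac{c_h}{\theta_q}+c_q$.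 An arrival rate policy is $\vec\lambda\in\Pi=[0,\Lambda]^N\times\{0\}$; its steady-state probabilities are $P_n(\vec\lambda)=a_n(\vec\lambda)/\sum_{i=0}^Na_i(\vec\lambda)$ with $a_0(\vec\lambda)=1$, $a_n(\vec\lambda)=\prod_{i=1}^n\lambda_{i-1}/\gamma_i$, and its long-run average gain is $g^{\vec\lambda}=\sum_{n=0}^Nr_n(\lambda_n)P_n(\vec\lambda)$. The optimal dynamic gain is $g^*=\max_{\vec\lambda\in\Pi}g^{\vec\lambda}$. Cutoff-static policy: for $K\in\{0,\ldots,N\}$ and $\delta\in[0,\Lambda]$, $\pi_K^\delta\in\Pi$ has arrival rate $\delta$ in states $0\le n<K$ and $0$ in states $K\le n\le N$; its gain is $g_C^\delta(K)=g^{\pi_K^\delta}$. The best cutoff-static gain is $g_C^*=\max_{K=0,\ldots,N}\max_{\delta\in[0,\Lambda]}g_C^\delta(K)$. *)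

theory Defs
  imports "HOL-Probability.Probability"
begin

record queue =
  servers :: nat          \<comment> \<open>\<open>m\<close>\<close>
  capacity :: nat         \<comment> \<open>\<open>N\<close>\<close>
  max_rate :: real        \<comment> \<open>\<open>\<Lambda>\<close>\<close>
  service_rate :: real    \<comment> \<open>\<open>\<mu>\<close>\<close>
  theta_s :: real         \<comment> \<open>abandonment rate in service\<close>
  theta_q :: real         \<comment> \<open>abandonment rate while waiting\<close>
  cost_h :: real          \<comment> \<open>holding cost\<close>
  cost_s :: real          \<comment> \<open>abandonment cost in service\<close>
  cost_q :: real          \<comment> \<open>abandonment cost while waiting\<close>
  supp_lo :: real         \<comment> \<open>\<open>a\<close>\<close>
  supp_hi :: real         \<comment> \<open>\<open>b\<close>\<close>
  eval_cdf :: "real \<Rightarrow> real" \<comment> \<open>\<open>F\<close>\<close>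

text \<open>
  Densities are only determined up to null sets, so positivity on \<open>[a,b]\<close> is asked of
  some version \<open>f\<close>. The conditions \<open>F a = 0\<close> and \<open>F b = 1\<close> force \<open>f\<close> to vanish almost
  everywhere outside \<open>[a,b]\<close>.
\<close>

definition positive_density_cdf :: "(real \<Rightarrow> real) \<Rightarrow> real \<Rightarrow> real \<Rightarrow> bool" where
  "positive_density_cdf F a b \<longleftrightarrow>
     continuous_on UNIV F \<and> F a = 0 \<and> F b = 1 \<and>
     (\<exists>f :: real \<Rightarrow> real. f \<in> borel_measurable borel \<and> (\<forall>x. 0 \<le> f x) \<and> (\<forall>x\<in>{a..b}. 0 < f x) \<and>
        prob_space (density lborel (\<lambda>x. ennreal (f x))) \<and>
        F = cdf (density lborel (\<lambda>x. ennreal (f x))))"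

definition queue_model :: "queue \<Rightarrow> bool" where
  "queue_model Q \<longleftrightarrow>
     1 \<le> servers Q \<and> servers Q \<le> capacity Q \<and>
     0 < max_rate Q \<and> 0 < service_rate Q \<and> 0 < theta_q Q \<and> 0 \<le> theta_s Q \<and>
     0 \<le> cost_h Q \<and> 0 \<le> cost_q Q \<and> 0 \<le> cost_s Q \<and>
     0 \<le> supp_lo Q \<and> supp_lo Q < supp_hi Q \<and>
     positive_density_cdf (eval_cdf Q) (supp_lo Q) (supp_hi Q)"

definition ccdf :: "queue \<Rightarrow> real \<Rightarrow> real" where
  "ccdf Q x = 1 - eval_cdf Q x"

definition ccdf_inv :: "queue \<Rightarrow> real \<Rightarrow> real" where
  "ccdf_inv Q y = Inf {x \<in> {supp_lo Q..supp_hi Q}. ccdf Q x \<le> y}"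

definition revenue_rate :: "queue \<Rightarrow> real \<Rightarrow> real" where
  "revenue_rate Q l = l * ccdf_inv Q (l / max_rate Q)"

definition regular :: "queue \<Rightarrow> bool" where
  "regular Q \<longleftrightarrow> continuous_on {0..max_rate Q} (revenue_rate Q) \<and>
                concave_on {0..max_rate Q} (revenue_rate Q)"

text \<open>
  Natural-number subtraction: \<open>n - servers Q\<close> below is \<open>max {n - m, 0}\<close>.
\<close>

definition departure_rate :: "queue \<Rightarrow> nat \<Rightarrow> real" where
  "departure_rate Q n =
     real (min n (servers Q)) * (service_rate Q + theta_s Q) + real (n - servers Q) * theta_q Q"

definition reward_rate :: "queue \<Rightarrow> nat \<Rightarrow> real \<Rightarrow> real" where
  "reward_rate Q n l =
     revenue_rate Q l - real n * cost_h Q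
     - real (min n (servers Q)) * cost_s Q * theta_s Q
     - real (n - servers Q) * cost_q Q * theta_q Q"

definition Cost_s :: "queue \<Rightarrow> real" where
  "Cost_s Q = (cost_h Q + cost_s Q * theta_s Q) / (service_rate Q + theta_s Q)"

definition Cost_q :: "queue \<Rightarrow> real" where
  "Cost_q Q = cost_h Q / theta_q Q + cost_q Q"

text \<open>
  An element of \<open>[0,\<Lambda>]\<^sup>N \<times> {0}\<close>, indexed by the states \<open>0, \<dots>, N\<close>, is encoded as a function
  on \<open>nat\<close> that is padded with \<open>0\<close> beyond \<open>N\<close>.
\<close>

definition policies :: "queue \<Rightarrow> (nat \<Rightarrow> real) set" where
  "policies Q = {l. (\<forall>n<capacity Q. l n \<in> {0..max_rate Q}) \<and> (\<forall>n\<ge>capacity Q. l n = 0)}"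

definition weight :: "queue \<Rightarrow> (nat \<Rightarrow> real) \<Rightarrow> nat \<Rightarrow> real" where
  "weight Q l n = (\<Prod>i=1..n. l (i - 1) / departure_rate Q i)"

definition steady_prob :: "queue \<Rightarrow> (nat \<Rightarrow> real) \<Rightarrow> nat \<Rightarrow> real" where
  "steady_prob Q l n = weight Q l n / (\<Sum>i=0..capacity Q. weight Q l i)"

definition gain :: "queue \<Rightarrow> (nat \<Rightarrow> real) \<Rightarrow> real" where
  "gain Q l = (\<Sum>n=0..capacity Q. reward_rate Q n (l n) * steady_prob Q l n)"

text \<open>
  The attained maximum of \<open>f\<close> over a possibly infinite set; unspecified if it is not attained.
\<close>

definition maximum_on :: "'a set \<Rightarrow> ('a \<Rightarrow> real) \<Rightarrow> real" where
  "maximum_on S f = (GREATEST y. y \<in> f ` S)"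

definition optimal_gain :: "queue \<Rightarrow> real" where
  "optimal_gain Q = maximum_on (policies Q) (gain Q)"

definition cutoff_policy :: "nat \<Rightarrow> real \<Rightarrow> nat \<Rightarrow> real" where
  "cutoff_policy K d n = (if n < K then d else 0)"

definition best_cutoff_gain :: "queue \<Rightarrow> real" where
  "best_cutoff_gain Q =
     maximum_on {0..capacity Q} (\<lambda>K. maximum_on {0..max_rate Q} (\<lambda>d. gain Q (cutoff_policy K d)))"

end

theory Submission imports Defs begin

text \<open>
  By detailed balance, the costs incurred in state \<open>n + 1\<close> can be charged to the customers
  admitted in state \<open>n\<close>. Each such customer then costs \<open>c\<^sub>n\<^sub>+\<^sub>1\<close>, the cost rate of state \<open>n + 1\<close>
  divided by its departure rate, and the gain is the stationary average of
  \<open>revenue \<lambda>\<^sub>n - \<lambda>\<^sub>n c\<^sub>n\<^sub>+\<^sub>1\<close>. As long as a server is free this cost is \<open>\<C>\<^sub>s\<close>. From then on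
  it is a mixture of \<open>\<C>\<^sub>s\<close> and \<open>\<C>\<^sub>q\<close> that does not fall as the queue grows, and the vanishing
  of the complementary distribution function at the first such mixture means that almost
  no valuation exceeds it. So queueing never pays: a policy of positive gain does not
  lose by turning customers away when all \<open>m\<close> servers are busy, and the model becomes a loss
  system with the concave margin \<open>H(\<lambda>) = revenue \<lambda> - \<lambda> \<C>\<^sub>s\<close>.

  Given a dynamic policy, let \<open>d\<close> be its mean arrival rate conditional on a free server, and
  let \<open>P\<^sub>m\<close> be the probability that all servers are busy in the loss system. Jensen's
  inequality bounds the gain by \<open>H(d) (1 - P\<^sub>m)\<close>, while the cutoff policy with rate \<open>d\<close> and
  cutoff \<open>m\<close> earns exactly \<open>H(d) \<rho>\<^sub>m(x)\<close>, where \<open>x = d / (\<mu> + \<theta>\<^sub>s)\<close> is the offered load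
  and \<open>\<rho>\<^sub>m\<close> is the Erlang acceptance probability. Only \<open>P\<^sub>m\<close> still refers to the dynamic
  policy. Counting busy servers gives
  \<open>x (1 - P\<^sub>m) = E(busy servers) \<le> (m - 1) (1 - P\<^sub>m) + m P\<^sub>m\<close>, hence
  \<open>1 - P\<^sub>m \<le> min 1 (m / (1 + x))\<close>. It remains to show
  \<open>\<rho>\<^sub>m(x) \<ge> 15/19 min 1 (m / (1 + x))\<close>, a statement about truncated exponential series
  (lemma \<open>acceptance_bound\<close>). The constant is \<open>\<rho>\<^sub>3(2)\<close>: equality occurs for three servers
  at offered load \<open>2\<close>.
\<close>

section \<open>Acceptance in an Erlang loss system\<close>

text \<open>
  One minus the Erlang B blocking probability of \<open>m\<close> servers at offered load \<open>x\<close>.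
\<close>
definition acceptance :: "nat \<Rightarrow> real \<Rightarrow> real" where
  "acceptance m x = (\<Sum>n<m. x ^ n / fact n) / (\<Sum>n\<le>m. x ^ n / fact n)"

lemma partial_exp_pos: "0 \<le> x \<Longrightarrow> 0 < (\<Sum>n\<le>m. x ^ n / fact n)" for x :: real
  by (rule sum_pos2[of _ 0]) auto

lemma acceptance_0: "acceptance 0 x = 0"
  by (simp add: acceptance_def)

lemma acceptance_le_1: "0 \<le> x \<Longrightarrow> acceptance m x \<le> 1"
  using partial_exp_pos[of x m]
  by (simp add: acceptance_def divide_le_eq lessThan_Suc_atMost[symmetric])

text \<open>
  The Erlang B recursion. It drives both the monotonicity in the load and the lower bound by
  induction on the number of servers.
\<close>
lemma acceptance_Suc:
  assumes "0 \<le> x"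
  shows "acceptance (Suc m) x = real (Suc m) / (real (Suc m) + x * (1 - acceptance m x))"
proof -
  define S where "S = (\<Sum>n\<le>m. x ^ n / fact n)"
  define T where "T = (\<Sum>n<m. x ^ n / fact n)"
  have S: "0 < S" unfolding S_def by (rule partial_exp_pos[OF assms])
  have ST: "S = T + x ^ m / fact m"
    by (simp add: S_def T_def lessThan_Suc_atMost[symmetric])
  have "acceptance (Suc m) x = S / (S + x ^ Suc m / fact (Suc m))"
    by (simp add: acceptance_def S_def lessThan_Suc_atMost)
  also have "x ^ Suc m / fact (Suc m) = x / real (Suc m) * (S - T)"
    by (simp add: ST)
  also have "S - T = S * (1 - acceptance m x)"
    using S by (simp add: acceptance_def S_def[symmetric] T_def[symmetric] field_simps)
  also have "S + x / real (Suc m) * (S * (1 - acceptance m x))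
      = S * (1 + x / real (Suc m) * (1 - acceptance m x))"
    by (simp add: distrib_left mult.left_commute del: of_nat_Suc)
  also have "S / \<dots> = 1 / (1 + x / real (Suc m) * (1 - acceptance m x))"
    using S by simp
  also have "\<dots> = real (Suc m) / (real (Suc m) + x * (1 - acceptance m x))"
    by (simp add: divide_simps del: of_nat_Suc)
  finally show ?thesis .
qed

lemma acceptance_antimono:
  assumes "0 \<le> x" "x \<le> y"
  shows "acceptance m y \<le> acceptance m x"
proof (induction m)
  case (Suc m)
  have "x * (1 - acceptance m x) \<le> y * (1 - acceptance m y)"
    using Suc assms acceptance_le_1[of x m] by (intro mult_mono) auto
  moreover have "0 \<le> x * (1 - acceptance m x)"
    using assms acceptance_le_1[of x m] by simp
  ultimately show ?case
    using assms by (auto simp: acceptance_Suc intro!: divide_left_mono mult_pos_pos)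
qed (simp add: acceptance_0)

text \<open>
  Clearing denominators turns the claim into a polynomial inequality in \<open>x\<close>. Expanded in
  powers of \<open>t = x - (m - 1) \<ge> 0\<close>, all coefficients of the difference are nonnegative; the
  constant one vanishes for \<open>m = 3\<close>, which is the extremal case.
\<close>
lemma acceptance_bound_small:
  assumes "1 \<le> m" "m \<le> 8" "real m - 1 \<le> x"
  shows "15 / 19 * (real m / (1 + x)) \<le> acceptance m x"
proof -
  define t where "t = x - (real m - 1)"
  have t: "0 \<le> t" and x: "x = real m - 1 + t" and x0: "0 \<le> x"
    using assms by (auto simp: t_def)
  have "15 * real m * (\<Sum>n<Suc m. x ^ n / fact n) \<le> 19 * (1 + x) * (\<Sum>n<m. x ^ n / fact n)"
  proof -
    from assms(1,2) consider "m = 1" | "m = 2" | "m = 3" | "m = 4" | "m = 5" | "m = 6" | "m = 7" | "m = 8"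
      by linarith
    then show ?thesis
      by cases (use t in \<open>simp_all add: x lessThan_nat_numeral fact_numeral
          power_numeral_reduce field_simps add_nonneg_nonneg\<close>)
  qed
  then show ?thesis
    using partial_exp_pos[OF x0, of m] x0
    by (simp add: acceptance_def lessThan_Suc_atMost field_simps)
qed

text \<open>
  Inserting the bound for \<open>m\<close> into the Erlang recursion loses a little, because \<open>x \<ge> m\<close>
  is one more than the load at which that bound is sharpest. The slack in the constant
  absorbs this loss from nine servers on, so the polynomial cases up to eight servers form
  the base of the induction.
\<close>
lemma acceptance_bound_heavy:
  assumes "1 \<le> m" "real m - 1 \<le> x"
  shows "15 / 19 * (real m / (1 + x)) \<le> acceptance m x"
  using assms
proof (induction m)
  case (Suc m)
  show ?case
  proof (cases "Suc m \<le> 8")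
    case True
    then show ?thesis using acceptance_bound_small Suc.prems by blast
  next
    case False
    define t where "t = x - real m"
    define k where "k = real m - 8"
    have t: "0 \<le> t" and k: "0 \<le> k" and x: "x = k + 8 + t" and m: "real m = k + 8"
      using Suc.prems False by (auto simp: t_def k_def)
    have x0: "0 < x" using t k x by simp
    have IH: "15 / 19 * (real m / (1 + x)) \<le> acceptance m x"
      using Suc False by simp
    have den: "0 < real (Suc m) + x * (1 - acceptance m x)"
      using acceptance_le_1[of x m] x0 by (simp add: add_pos_nonneg)
    \<comment> \<open>The induction step with denominators cleared: \<open>361 = 19\<^sup>2\<close>, \<open>285 = 15 \<cdot> 19\<close>, \<open>225 = 15\<^sup>2\<close>.\<close>
    have "285 * (1 + x) * (k + 9) + x * (285 * (1 + x) - 225 * (k + 8)) \<le> 361 * (1 + x) * (1 + x)"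
    proof -
      have "0 \<le> k * k" "0 \<le> k * t" "0 \<le> t * t"
        using t k by auto
      then show ?thesis using t k unfolding x
        by (simp add: algebra_simps)
    qed
    then have "15 * (real (Suc m) + x * (1 - 15 / 19 * (real m / (1 + x)))) \<le> 19 * (1 + x)"
      using x0 by (simp add: m field_simps)
    moreover have "x * (1 - acceptance m x) \<le> x * (1 - 15 / 19 * (real m / (1 + x)))"
      using IH x0 by (intro mult_left_mono) auto
    ultimately have *: "15 * (real (Suc m) + x * (1 - acceptance m x)) \<le> 19 * (1 + x)"
      by (smt (verit))
    have "15 / (19 * (1 + x)) \<le> 1 / (real (Suc m) + x * (1 - acceptance m x))"
      using * den x0 by (simp add: divide_simps del: of_nat_Suc)
    then have "real (Suc m) * (15 / (19 * (1 + x))) \<le> real (Suc m) * (1 / (real (Suc m) + x * (1 - acceptance m x)))"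
      by (intro mult_left_mono) auto
    then show ?thesis
      using x0 by (simp add: acceptance_Suc distrib_left mult.commute del: of_nat_Suc)
  qed
qed simp

text \<open>
  The two branches of the minimum meet at \<open>x = m - 1\<close>. Below that load the acceptance
  probability is at least its value there, since it decreases with the load.
\<close>
lemma acceptance_bound:
  assumes "1 \<le> m" "0 \<le> x"
  shows "15 / 19 * min 1 (real m / (1 + x)) \<le> acceptance m x"
proof (cases "real m - 1 \<le> x")
  case True
  have "15 / 19 * min 1 (real m / (1 + x)) \<le> 15 / 19 * (real m / (1 + x))"
    by (intro mult_left_mono) auto
  then show ?thesis using acceptance_bound_heavy[OF assms(1) True] by linarith
next
  case False
  have "15 / 19 * min 1 (real m / (1 + x)) \<le> 15 / 19 * (real m / (1 + (real m - 1)))"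
    using assms(1) by simp
  also have "\<dots> \<le> acceptance m (real m - 1)"
    using acceptance_bound_heavy[OF assms(1)] by blast
  also have "\<dots> \<le> acceptance m x"
    using acceptance_antimono assms(2) False by simp
  finally show ?thesis .
qed
section \<open>Attained maxima\<close>

lemma maximum_on_eq:
  assumes "x \<in> S" "\<And>y. y \<in> S \<Longrightarrow> f y \<le> f x"
  shows "maximum_on S f = f x"
  unfolding maximum_on_def using assms by (intro Greatest_equality) auto

lemma maximum_on_compact:
  fixes f :: "'a::topological_space \<Rightarrow> real"
  assumes "compact S" "S \<noteq> {}" "continuous_on S f"
  obtains x where "x \<in> S" "maximum_on S f = f x" "\<And>y. y \<in> S \<Longrightarrow> f y \<le> f x"
proof -
  obtain x where "x \<in> S" "\<And>y. y \<in> S \<Longrightarrow> f y \<le> f x"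
    using continuous_attains_sup[OF assms] by blast
  then show ?thesis using maximum_on_eq[of x S f] that by blast
qed

lemma maximum_on_finite:
  assumes "finite S" "y \<in> S"
  shows "f y \<le> maximum_on S f"
proof -
  have "Max (f ` S) \<in> f ` S" using assms by (intro Max_in) auto
  then obtain x where x: "x \<in> S" "f x = Max (f ` S)" by auto
  have "f z \<le> f x" if "z \<in> S" for z
    using assms(1) that by (simp add: x)
  then show ?thesis using maximum_on_eq[of x S f] x(1) assms(2) by simp
qed

section \<open>Gain as an average of margins\<close>

text \<open>
  The division prices a departure: multiplied by the departure rate this is the cost rate of
  state \<open>n\<close>, so each customer who moves the system into state \<open>n\<close> can be charged this amount.
\<close>
definition departure_cost :: "queue \<Rightarrow> nat \<Rightarrow> real" where
  "departure_cost Q n =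
     (real n * cost_h Q + real (min n (servers Q)) * cost_s Q * theta_s Q
      + real (n - servers Q) * cost_q Q * theta_q Q) / departure_rate Q n"

text \<open>
  The net earning rate from arrivals at rate \<open>d\<close> when each is charged the cost of a customer
  who finds a free server.
\<close>
definition margin :: "queue \<Rightarrow> real \<Rightarrow> real" where
  "margin Q d = revenue_rate Q d - d * Cost_s Q"

text \<open>
  The next two definitions describe the stationary law conditional on a free server:
  \<open>free_mass\<close> is its normalising constant and \<open>mean_free_rate\<close> its mean arrival rate, which
  serves as the rate of the competing static policy.
\<close>
definition free_mass :: "queue \<Rightarrow> (nat \<Rightarrow> real) \<Rightarrow> real" where
  "free_mass Q l = (\<Sum>n<servers Q. weight Q l n)"

definition mean_free_rate :: "queue \<Rightarrow> (nat \<Rightarrow> real) \<Rightarrow> real" where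
  "mean_free_rate Q l = (\<Sum>n<servers Q. weight Q l n / free_mass Q l * l n)"

context
  fixes Q :: queue
  assumes model: "queue_model Q"
begin

lemma departure_rate_pos:
  assumes "1 \<le> n"
  shows "0 < departure_rate Q n"
proof -
  have "0 < real (min n (servers Q)) * (service_rate Q + theta_s Q)"
    using assms model by (intro mult_pos_pos) (auto simp: queue_model_def)
  moreover have "0 \<le> real (n - servers Q) * theta_q Q"
    using model by (auto simp: queue_model_def)
  ultimately show ?thesis by (simp add: departure_rate_def)
qed

lemma departure_cost_below:
  assumes "1 \<le> n" "n \<le> servers Q"
  shows "departure_cost Q n = Cost_s Q"
proof -
  have "0 < service_rate Q + theta_s Q" using model by (auto simp: queue_model_def)
  then show ?thesis
    using assms by (simp add: departure_cost_def Cost_s_def departure_rate_def divide_simps)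
      (simp add: algebra_simps)
qed

text \<open>
  With all servers busy, a fraction \<open>\<gamma>\<^sub>m / \<gamma>\<^sub>n\<close> of the departures leave a server, after
  completion or abandonment, and the rest abandon the queue. These are the weights.
\<close>
lemma departure_cost_above:
  assumes "servers Q \<le> n"
  shows "departure_cost Q n =
    departure_rate Q (servers Q) / departure_rate Q n * Cost_s Q
    + (departure_rate Q n - departure_rate Q (servers Q)) / departure_rate Q n * Cost_q Q"
proof -
  define m g where "m = real (servers Q)" and "g = service_rate Q + theta_s Q"
  have g: "0 < g" and q: "0 < theta_q Q" and n: "1 \<le> n"
    using model assms by (auto simp: queue_model_def g_def)
  have D: "departure_rate Q (servers Q) = m * g"
    "departure_rate Q n - departure_rate Q (servers Q) = (real n - m) * theta_q Q"
    using assms by (simp_all add: departure_rate_def m_def g_def of_nat_diff)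
  have "real n * cost_h Q + m * cost_s Q * theta_s Q + (real n - m) * cost_q Q * theta_q Q
      = m * g * Cost_s Q + (real n - m) * theta_q Q * Cost_q Q"
    using g q by (simp add: Cost_s_def Cost_q_def g_def[symmetric] field_simps)
  then have "departure_cost Q n =
      (m * g * Cost_s Q + (real n - m) * theta_q Q * Cost_q Q) / departure_rate Q n"
    using assms by (simp add: departure_cost_def m_def of_nat_diff min_absorb2)
  then show ?thesis by (simp only: D(2)) (simp only: D(1) add_divide_distrib times_divide_eq_left)
qed

lemma departure_cost_mono:
  assumes "Cost_s Q \<le> Cost_q Q" "servers Q \<le> k" "k \<le> n"
  shows "departure_cost Q k \<le> departure_cost Q n"
proof -
  define g where "g = departure_rate Q (servers Q)"
  have m: "1 \<le> servers Q" using model by (simp add: queue_model_def)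
  have pos: "0 < departure_rate Q k" "0 < departure_rate Q n" "0 < g"
    using assms m by (auto simp: g_def intro!: departure_rate_pos)
  have le: "departure_rate Q k \<le> departure_rate Q n"
    using assms model by (auto simp: departure_rate_def queue_model_def intro!: mult_right_mono)
  have eq: "departure_cost Q i = Cost_q Q - g / departure_rate Q i * (Cost_q Q - Cost_s Q)"
    if "0 < departure_rate Q i" "servers Q \<le> i" for i
    using that by (simp add: departure_cost_above g_def field_simps)
  have "g / departure_rate Q n \<le> g / departure_rate Q k"
    using le pos by (intro divide_left_mono) auto
  then have "g / departure_rate Q n * (Cost_q Q - Cost_s Q)
      \<le> g / departure_rate Q k * (Cost_q Q - Cost_s Q)"
    using assms(1) by (intro mult_right_mono) auto
  then show ?thesis using eq pos assms by simp
qed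

lemma weight_0: "weight Q l 0 = 1"
  by (simp add: weight_def)

lemma weight_nonneg:
  assumes "l \<in> policies Q"
  shows "0 \<le> weight Q l n"
  unfolding weight_def
proof (rule prod_nonneg)
  fix i assume "i \<in> {1..n}"
  then have "0 < departure_rate Q i" by (intro departure_rate_pos) simp
  moreover have "0 \<le> l (i - 1)"
    using assms by (cases "i - 1 < capacity Q") (auto simp: policies_def)
  ultimately show "0 \<le> l (i - 1) / departure_rate Q i" by simp
qed

lemma weight_sum_pos:
  assumes "l \<in> policies Q"
  shows "0 < (\<Sum>n\<le>k. weight Q l n)"
  using weight_nonneg[OF assms] by (intro sum_pos2[of _ 0]) (auto simp: weight_0)

lemma detailed_balance:
  "departure_rate Q (Suc n) * weight Q l (Suc n) = l n * weight Q l n"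
  using departure_rate_pos[of "Suc n"] by (simp add: weight_def)

text \<open>
  The cost of state \<open>n + 1\<close> is moved down to state \<open>n\<close> by detailed balance. The top state
  contributes nothing because no customer is admitted there.
\<close>
lemma gain_eq_margin_average:
  assumes "l \<in> policies Q"
  shows "gain Q l =
    (\<Sum>n<capacity Q. (revenue_rate Q (l n) - l n * departure_cost Q (Suc n)) * weight Q l n)
      / (\<Sum>n\<le>capacity Q. weight Q l n)"
proof -
  let ?w = "weight Q l" and ?N = "capacity Q"
  define h where "h n = departure_rate Q n * departure_cost Q n * ?w n" for n
  have h0: "h 0 = 0" by (simp add: h_def departure_cost_def)
  have hS: "h (Suc n) = l n * departure_cost Q (Suc n) * ?w n" for n
    using detailed_balance[of n l] by (simp add: h_def mult.assoc mult.left_commute)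
  have r: "reward_rate Q n x * ?w n = revenue_rate Q x * ?w n - h n" for n x
  proof (cases "n = 0")
    case False
    then have "departure_rate Q n * departure_cost Q n =
        real n * cost_h Q + real (min n (servers Q)) * cost_s Q * theta_s Q
        + real (n - servers Q) * cost_q Q * theta_q Q"
      using departure_rate_pos[of n] by (simp add: departure_cost_def)
    then show ?thesis by (simp add: reward_rate_def h_def algebra_simps)
  qed (simp add: reward_rate_def h_def departure_cost_def)
  have last: "revenue_rate Q (l ?N) * ?w ?N = 0"
    using assms by (simp add: policies_def revenue_rate_def)
  have "(\<Sum>n\<le>?N. reward_rate Q n (l n) * ?w n) = (\<Sum>n\<le>?N. revenue_rate Q (l n) * ?w n) - (\<Sum>n\<le>?N. h n)"
    by (simp add: r sum_subtractf)
  also have "(\<Sum>n\<le>?N. revenue_rate Q (l n) * ?w n) = (\<Sum>n<?N. revenue_rate Q (l n) * ?w n)"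
    using last by (simp add: lessThan_Suc_atMost[symmetric])
  also have "(\<Sum>n\<le>?N. h n) = (\<Sum>n<?N. l n * departure_cost Q (Suc n) * ?w n)"
    by (simp add: sum.atMost_shift h0 hS)
  finally have "(\<Sum>n\<le>?N. reward_rate Q n (l n) * ?w n)
      = (\<Sum>n<?N. (revenue_rate Q (l n) - l n * departure_cost Q (Suc n)) * ?w n)"
    by (simp add: sum_subtractf algebra_simps)
  moreover have "gain Q l = (\<Sum>n\<le>?N. reward_rate Q n (l n) * ?w n) / (\<Sum>n\<le>?N. ?w n)"
    by (simp add: gain_def steady_prob_def atLeast0AtMost sum_divide_distrib)
  ultimately show ?thesis by simp
qed

section \<open>Existence of optimal policies\<close>

text \<open>
  A policy is a function on all of \<open>nat\<close>, so the policy space is a product of compact factors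
  (intervals, and singletons beyond the capacity) in the product topology.
\<close>
lemma compact_policies: "compact (policies Q)"
proof -
  have "policies Q = Pi\<^sub>E UNIV (\<lambda>n. if n < capacity Q then {0..max_rate Q} else {0})"
    by (auto simp: policies_def PiE_iff not_less split: if_split_asm)
      (metis not_less)+
  moreover have "compactin (product_topology (\<lambda>i. euclidean) UNIV)
      (Pi\<^sub>E UNIV (\<lambda>n. if n < capacity Q then {0..max_rate Q} else {0::real}))"
    by (subst compactin_PiE) auto
  ultimately show ?thesis by (simp add: euclidean_product_topology)
qed

lemma policies_nonempty: "policies Q \<noteq> {}"
proof -
  have "(\<lambda>n. 0) \<in> policies Q" using model by (auto simp: policies_def queue_model_def)
  then show ?thesis by blast
qed

lemma policies_range:
  assumes "l \<in> policies Q"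
  shows "l n \<in> {0..max_rate Q}"
  using assms model by (cases "n < capacity Q") (auto simp: policies_def queue_model_def)

lemma cutoff_policy_in_policies:
  assumes "K \<le> capacity Q" "d \<in> {0..max_rate Q}"
  shows "cutoff_policy K d \<in> policies Q"
  using assms by (auto simp: policies_def cutoff_policy_def)

lemma continuous_on_gain:
  assumes "regular Q"
  shows "continuous_on (policies Q) (gain Q)"
proof -
  have coord: "continuous_on (policies Q) (\<lambda>l. l n)" for n
    by (rule continuous_on_subset[OF continuous_on_product_coordinates]) simp
  have rev: "continuous_on (policies Q) (\<lambda>l. revenue_rate Q (l n))" for n
    by (rule continuous_on_compose2[OF _ coord])
       (use assms policies_range in \<open>auto simp: regular_def\<close>)
  have w: "continuous_on (policies Q) (\<lambda>l. weight Q l n)" for n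
    unfolding weight_def by (intro continuous_on_prod continuous_on_divide continuous_on_const coord)
       (auto intro!: departure_rate_pos less_imp_neq[symmetric])
  have "(\<Sum>i=0..capacity Q. weight Q l i) \<noteq> 0" if "l \<in> policies Q" for l
    using weight_sum_pos[OF that, of "capacity Q"] by (simp add: atLeast0AtMost)
  then show ?thesis
    unfolding gain_def reward_rate_def steady_prob_def
    by (intro continuous_on_sum continuous_on_mult continuous_on_diff continuous_on_divide
        continuous_on_const rev w) auto
qed

lemma optimal_gain_attained:
  assumes "regular Q"
  obtains l where "l \<in> policies Q" "optimal_gain Q = gain Q l"
    "\<And>l'. l' \<in> policies Q \<Longrightarrow> gain Q l' \<le> gain Q l"
  using maximum_on_compact[OF compact_policies policies_nonempty continuous_on_gain[OF assms]]
  unfolding optimal_gain_def by blast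

lemma cutoff_gain_le_best:
  assumes "regular Q" "K \<le> capacity Q" "d \<in> {0..max_rate Q}"
  shows "gain Q (cutoff_policy K d) \<le> best_cutoff_gain Q"
proof -
  have "continuous_on {0..max_rate Q} (\<lambda>d. cutoff_policy K d)"
    unfolding cutoff_policy_def
  proof (rule continuous_on_coordinatewise_then_product)
    show "continuous_on {0..max_rate Q} (\<lambda>d. if n < K then d else 0)" for n
      by (cases "n < K") (auto intro: continuous_intros)
  qed
  then have "continuous_on {0..max_rate Q} (\<lambda>d. gain Q (cutoff_policy K d))"
    using cutoff_policy_in_policies[OF assms(2)]
    by (intro continuous_on_compose2[OF continuous_on_gain[OF assms(1)]]) auto
  then obtain x where "maximum_on {0..max_rate Q} (\<lambda>d. gain Q (cutoff_policy K d)) = gain Q (cutoff_policy K x)"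
    "\<And>y. y \<in> {0..max_rate Q} \<Longrightarrow> gain Q (cutoff_policy K y) \<le> gain Q (cutoff_policy K x)"
    using maximum_on_compact[of "{0..max_rate Q}"] assms(3)
    by (metis compact_Icc empty_iff)
  then have "gain Q (cutoff_policy K d) \<le> maximum_on {0..max_rate Q} (\<lambda>d. gain Q (cutoff_policy K d))"
    using assms(3) by simp
  also have "\<dots> \<le> best_cutoff_gain Q"
    unfolding best_cutoff_gain_def
    by (rule maximum_on_finite[of "{0..capacity Q}" K
          "\<lambda>K. maximum_on {0..max_rate Q} (\<lambda>d. gain Q (cutoff_policy K d))"]) (use assms in auto)
  finally show ?thesis .
qed

section \<open>Valuations\<close>

lemma ccdf_antimono:
  assumes "x \<le> y"
  shows "ccdf Q y \<le> ccdf Q x"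
proof -
  obtain f where f: "prob_space (density lborel (\<lambda>x. ennreal (f x)))"
    "eval_cdf Q = cdf (density lborel (\<lambda>x. ennreal (f x)))"
    using model by (auto simp: queue_model_def positive_density_cdf_def)
  interpret prob_space "density lborel (\<lambda>x. ennreal (f x))" by (rule f)
  show ?thesis
    using assms by (auto simp: ccdf_def f(2) cdf_def intro!: finite_measure_mono)
qed

lemma ccdf_ends: "ccdf Q (supp_lo Q) = 1" "ccdf Q (supp_hi Q) = 0"
  using model by (auto simp: queue_model_def positive_density_cdf_def ccdf_def)

lemma ccdf_inv_le:
  assumes "ccdf Q c = 0" "0 \<le> y"
  shows "ccdf_inv Q y \<le> c"
proof -
  have c: "supp_lo Q \<le> c" and ab: "supp_lo Q < supp_hi Q"
    using ccdf_antimono[of c "supp_lo Q"] ccdf_ends assms model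
    by (force simp: queue_model_def)+
  have bdd: "bdd_below {x \<in> {supp_lo Q..supp_hi Q}. ccdf Q x \<le> y}"
    by (rule bdd_belowI[of _ "supp_lo Q"]) auto
  have "ccdf_inv Q y \<le> min c (supp_hi Q)"
    unfolding ccdf_inv_def
    by (rule cInf_lower[OF _ bdd]) (use c ab assms ccdf_ends in \<open>auto simp: min_def\<close>)
  then show ?thesis by simp
qed

text \<open>
  Continuity of the distribution function makes the infimum attained, which turns the
  inequality into a strict one.
\<close>
lemma ccdf_inv_gt:
  assumes "0 \<le> y" "y < ccdf Q c"
  shows "c < ccdf_inv Q y"
proof -
  let ?S = "{x \<in> {supp_lo Q..supp_hi Q}. ccdf Q x \<le> y}"
  have "continuous_on UNIV (ccdf Q)"
    using model unfolding ccdf_def queue_model_def positive_density_cdf_def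
    by (auto intro!: continuous_intros)
  then have "closed ({supp_lo Q..supp_hi Q} \<inter> {x. ccdf Q x \<le> y})"
    by (intro closed_Int closed_atLeastAtMost closed_Collect_le continuous_intros)
  moreover have "{supp_lo Q..supp_hi Q} \<inter> {x. ccdf Q x \<le> y} = ?S" by auto
  ultimately have "closed ?S" by simp
  moreover have "supp_hi Q \<in> ?S"
    using assms ccdf_ends model by (auto simp: queue_model_def)
  moreover have "bdd_below ?S" by (rule bdd_belowI[of _ "supp_lo Q"]) auto
  ultimately have "Inf ?S \<in> ?S" by (intro closed_contains_Inf) auto
  then have "ccdf Q (ccdf_inv Q y) \<le> y" by (simp add: ccdf_inv_def)
  then show ?thesis using ccdf_antimono[of "ccdf_inv Q y" c] assms by linarith
qed

text \<open>
  Some customers value service above its cost, so a low enough arrival rate is profitable.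
  This makes the optimal gain positive, without which the ratio of gains would carry no
  information.
\<close>
lemma margin_pos_exists:
  assumes "0 < ccdf Q (Cost_s Q)"
  obtains d where "d \<in> {0..max_rate Q}" "0 < margin Q d"
proof -
  define y where "y = ccdf Q (Cost_s Q) / 2"
  have L: "0 < max_rate Q" using model by (simp add: queue_model_def)
  have "0 \<le> eval_cdf Q (Cost_s Q)"
    using model by (auto simp: queue_model_def positive_density_cdf_def cdf_def)
  then have y: "0 < y" "y \<le> 1" "y < ccdf Q (Cost_s Q)"
    using assms by (auto simp: y_def ccdf_def)
  have "margin Q (max_rate Q * y) = max_rate Q * y * (ccdf_inv Q y - Cost_s Q)"
    using L by (simp add: margin_def revenue_rate_def algebra_simps)
  also have "\<dots> > 0"
    using ccdf_inv_gt[of y "Cost_s Q"] L y by simp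
  finally show ?thesis
    using that[of "max_rate Q * y"] L y by (simp add: mult_le_cancel_left1)
qed

section \<open>Dynamic and static policies\<close>

text \<open>
  Customers who join the queue cost at least \<open>c\<^sub>m\<^sub>+\<^sub>1\<close>, the cost at the front of the queue,
  and almost no valuation exceeds that.
\<close>
lemma queueing_unprofitable:
  assumes "Cost_s Q \<le> Cost_q Q" "ccdf Q (departure_cost Q (Suc (servers Q))) = 0"
    and "servers Q \<le> n" "0 \<le> x"
  shows "revenue_rate Q x - x * departure_cost Q (Suc n) \<le> 0"
proof -
  have "ccdf_inv Q (x / max_rate Q) \<le> departure_cost Q (Suc (servers Q))"
    using assms model by (intro ccdf_inv_le) (auto simp: queue_model_def)
  also have "\<dots> \<le> departure_cost Q (Suc n)"
    using assms by (intro departure_cost_mono) auto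
  finally show ?thesis using assms(4) by (simp add: revenue_rate_def mult_left_mono)
qed

text \<open>
  Dropping the queueing states removes nonpositive terms from the numerator and shrinks the
  normalising sum. The latter increases the quotient only because the remaining numerator is
  positive, which is where the positivity of the gain enters.
\<close>
lemma gain_le_loss_system_gain:
  assumes l: "l \<in> policies Q" and gain: "0 < gain Q l"
    and "Cost_s Q \<le> Cost_q Q" "ccdf Q (departure_cost Q (Suc (servers Q))) = 0"
  shows "gain Q l \<le> (\<Sum>n<servers Q. margin Q (l n) * weight Q l n)
                      / (\<Sum>n\<le>servers Q. weight Q l n)"
proof -
  let ?w = "weight Q l" and ?m = "servers Q" and ?N = "capacity Q"
  let ?term = "\<lambda>n. (revenue_rate Q (l n) - l n * departure_cost Q (Suc n)) * ?w n"
  define R where "R = (\<Sum>n<?m. margin Q (l n) * ?w n)"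
  have mN: "?m \<le> ?N" using model by (simp add: queue_model_def)
  have "(\<Sum>n<?N. ?term n) = (\<Sum>n<?m. ?term n) + (\<Sum>n=?m..<?N. ?term n)"
    using mN sum.atLeastLessThan_concat[of 0 ?m ?N ?term] by (simp add: atLeast0LessThan)
  also have "(\<Sum>n<?m. ?term n) = R"
    unfolding R_def by (intro sum.cong) (auto simp: margin_def departure_cost_below)
  also have "(\<Sum>n=?m..<?N. ?term n) \<le> 0"
    using queueing_unprofitable[OF assms(3,4)] policies_range[OF l] weight_nonneg[OF l]
    by (intro sum_nonpos mult_nonpos_nonneg) auto
  finally have num: "(\<Sum>n<?N. ?term n) \<le> R" by simp
  have W: "0 < (\<Sum>n\<le>?N. ?w n)" "0 < (\<Sum>n\<le>?m. ?w n)"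
    by (intro weight_sum_pos[OF l])+
  have "gain Q l \<le> R / (\<Sum>n\<le>?N. ?w n)"
    unfolding gain_eq_margin_average[OF l] using num W by (intro divide_right_mono) auto
  moreover from this have "0 < R" using gain W by (smt (verit) divide_nonpos_pos)
  moreover have "(\<Sum>n\<le>?m. ?w n) \<le> (\<Sum>n\<le>?N. ?w n)"
    using mN weight_nonneg[OF l] by (intro sum_mono2) auto
  ultimately show ?thesis
    unfolding R_def[symmetric] using W by (smt (verit) divide_left_mono mult_pos_pos)
qed

lemma free_mass_pos:
  assumes "l \<in> policies Q"
  shows "0 < free_mass Q l"
  unfolding free_mass_def using weight_nonneg[OF assms] model
  by (intro sum_pos2[of _ 0]) (auto simp: weight_0 queue_model_def)

lemma conditional_weights:
  assumes "l \<in> policies Q"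
  shows "(\<Sum>n<servers Q. weight Q l n / free_mass Q l) = 1"
  using free_mass_pos[OF assms]
  by (simp add: free_mass_def sum_divide_distrib[symmetric])

lemma mean_free_rate_range:
  assumes "l \<in> policies Q"
  shows "mean_free_rate Q l \<in> {0..max_rate Q}"
proof -
  have nonneg: "0 \<le> weight Q l n / free_mass Q l" for n
    using weight_nonneg[OF assms] free_mass_pos[OF assms] by (simp add: less_imp_le)
  have "0 \<le> mean_free_rate Q l"
    unfolding mean_free_rate_def
    using nonneg policies_range[OF assms] by (intro sum_nonneg mult_nonneg_nonneg) auto
  moreover have "mean_free_rate Q l \<le> (\<Sum>n<servers Q. weight Q l n / free_mass Q l * max_rate Q)"
    unfolding mean_free_rate_def
    using nonneg policies_range[OF assms] by (intro sum_mono mult_left_mono) auto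
  moreover have "(\<Sum>n<servers Q. weight Q l n / free_mass Q l * max_rate Q) = max_rate Q"
    by (simp only: sum_distrib_right[symmetric] conditional_weights[OF assms] mult_1_left)
  ultimately show ?thesis by simp
qed

lemma margin_jensen:
  assumes l: "l \<in> policies Q" and "regular Q"
  shows "(\<Sum>n<servers Q. margin Q (l n) * weight Q l n)
           \<le> free_mass Q l * margin Q (mean_free_rate Q l)"
proof -
  let ?p = "\<lambda>n. weight Q l n / free_mass Q l"
  have A: "0 < free_mass Q l" by (rule free_mass_pos[OF l])
  have "(\<Sum>n<servers Q. ?p n * revenue_rate Q (l n)) \<le> revenue_rate Q (\<Sum>n<servers Q. ?p n *\<^sub>R l n)"
    by (rule concave_on_sum[where C = "{0..max_rate Q}"])
       (use assms model policies_range[OF l] conditional_weights[OF l] weight_nonneg[OF l] A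
         in \<open>auto simp: regular_def queue_model_def lessThan_empty_iff\<close>)
  then have "(\<Sum>n<servers Q. ?p n * margin Q (l n)) \<le> margin Q (mean_free_rate Q l)"
    by (simp add: margin_def mean_free_rate_def algebra_simps sum_subtractf
        sum_distrib_left)
  then have "free_mass Q l * (\<Sum>n<servers Q. ?p n * margin Q (l n))
      \<le> free_mass Q l * margin Q (mean_free_rate Q l)"
    using A by (intro mult_left_mono) auto
  moreover have "free_mass Q l * (\<Sum>n<servers Q. ?p n * margin Q (l n))
      = (\<Sum>n<servers Q. margin Q (l n) * weight Q l n)"
    using A by (simp add: sum_distrib_left mult.commute)
  ultimately show ?thesis by simp
qed

text \<open>
  Little's law: the accepted load \<open>x (1 - P\<^sub>m)\<close> is the mean number of busy servers, which is at
  most \<open>m - 1\<close> while a server is free and \<open>m\<close> otherwise. Solving for \<open>1 - P\<^sub>m\<close> gives the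
  bound.
\<close>
lemma not_full_le:
  assumes l: "l \<in> policies Q"
  shows "free_mass Q l / (\<Sum>n\<le>servers Q. weight Q l n)
    \<le> min 1 (real (servers Q) / (1 + mean_free_rate Q l / (service_rate Q + theta_s Q)))"
proof -
  let ?w = "weight Q l" and ?m = "servers Q"
  define A g x where "A = free_mass Q l" and "g = service_rate Q + theta_s Q"
    and "x = mean_free_rate Q l / g"
  have g: "0 < g" using model by (auto simp: g_def queue_model_def)
  have A: "0 < A" unfolding A_def by (rule free_mass_pos[OF l])
  have x: "0 \<le> x" using mean_free_rate_range[OF l] g by (simp add: x_def)
  have total: "(\<Sum>n\<le>?m. ?w n) = A + ?w ?m"
    by (simp add: A_def free_mass_def lessThan_Suc_atMost[symmetric])
  have w: "0 \<le> ?w n" for n by (rule weight_nonneg[OF l])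
  have "g * (x * A) = (\<Sum>n<?m. l n * ?w n)"
    using A g by (simp add: x_def mean_free_rate_def A_def sum_divide_distrib[symmetric] mult.commute)
  also have "\<dots> = (\<Sum>n<?m. departure_rate Q (Suc n) * ?w (Suc n))"
    by (simp add: detailed_balance)
  also have "\<dots> = (\<Sum>n<?m. g * (real (Suc n) * ?w (Suc n)))"
    by (intro sum.cong) (auto simp: departure_rate_def g_def min_absorb1)
  also have "\<dots> = g * (\<Sum>n\<le>?m. real n * ?w n)"
    by (simp add: sum_distrib_left[symmetric] sum.atMost_shift del: of_nat_Suc)
  finally have "x * A = (\<Sum>n\<le>?m. real n * ?w n)" using g by simp
  also have "\<dots> = (\<Sum>n<?m. real n * ?w n) + real ?m * ?w ?m"
    by (simp add: lessThan_Suc_atMost[symmetric])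
  also have "(\<Sum>n<?m. real n * ?w n) \<le> (\<Sum>n<?m. (real ?m - 1) * ?w n)"
    using w by (intro sum_mono mult_right_mono) auto
  also have "\<dots> = (real ?m - 1) * A"
    by (simp add: A_def free_mass_def sum_distrib_left)
  finally have "(1 + x) * A \<le> real ?m * (A + ?w ?m)" by (simp add: algebra_simps)
  then have "A / (A + ?w ?m) \<le> real ?m / (1 + x)"
    using A w[of ?m] x by (simp add: field_simps add_pos_nonneg)
  then show ?thesis
    using A w[of ?m] by (simp add: total A_def[symmetric] x_def g_def)
qed

lemma weight_cutoff:
  assumes "n \<le> servers Q"
  shows "weight Q (cutoff_policy (servers Q) d) n = (d / (service_rate Q + theta_s Q)) ^ n / fact n"
  using assms
proof (induction n)
  case (Suc n)
  have "weight Q (cutoff_policy (servers Q) d) (Suc n)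
      = weight Q (cutoff_policy (servers Q) d) n * (d / departure_rate Q (Suc n))"
    using Suc.prems by (simp add: weight_def cutoff_policy_def)
  also have "departure_rate Q (Suc n) = real (Suc n) * (service_rate Q + theta_s Q)"
    using Suc.prems by (simp add: departure_rate_def min_absorb1)
  finally show ?case using Suc by (simp add: mult.commute)
qed (simp add: weight_0)

lemma gain_cutoff:
  assumes "d \<in> {0..max_rate Q}"
  shows "gain Q (cutoff_policy (servers Q) d)
    = margin Q d * acceptance (servers Q) (d / (service_rate Q + theta_s Q))"
proof -
  let ?m = "servers Q" and ?N = "capacity Q" and ?x = "d / (service_rate Q + theta_s Q)"
  let ?l = "cutoff_policy ?m d"
  have mN: "?m \<le> ?N" using model by (simp add: queue_model_def)
  have l: "?l \<in> policies Q" by (rule cutoff_policy_in_policies[OF mN assms])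
  have below: "?l n = d" if "n < ?m" for n
    using that by (simp add: cutoff_policy_def)
  have above: "weight Q ?l n = 0" if "?m < n" for n
    unfolding weight_def using that
    by (intro prod_zero) (auto intro!: bexI[of _ "Suc ?m"] simp: cutoff_policy_def)
  have "(\<Sum>n<?N. (revenue_rate Q (?l n) - ?l n * departure_cost Q (Suc n)) * weight Q ?l n)
      = (\<Sum>n<?m. (revenue_rate Q (?l n) - ?l n * departure_cost Q (Suc n)) * weight Q ?l n)"
    using mN by (intro sum.mono_neutral_right) (auto simp: cutoff_policy_def revenue_rate_def)
  also have "\<dots> = (\<Sum>n<?m. margin Q d * (?x ^ n / fact n))"
    by (intro sum.cong) (auto simp: below margin_def departure_cost_below weight_cutoff)
  also have "\<dots> = margin Q d * (\<Sum>n<?m. ?x ^ n / fact n)"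
    by (simp only: sum_distrib_left)
  finally have num: "(\<Sum>n<?N. (revenue_rate Q (?l n) - ?l n * departure_cost Q (Suc n)) * weight Q ?l n)
      = margin Q d * (\<Sum>n<?m. ?x ^ n / fact n)" .
  have "(\<Sum>n\<le>?N. weight Q ?l n) = (\<Sum>n\<le>?m. weight Q ?l n)"
    using mN above by (intro sum.mono_neutral_right) auto
  also have "\<dots> = (\<Sum>n\<le>?m. ?x ^ n / fact n)"
    by (intro sum.cong) (auto simp: weight_cutoff)
  finally have den: "(\<Sum>n\<le>?N. weight Q ?l n) = (\<Sum>n\<le>?m. ?x ^ n / fact n)" .
  show ?thesis
    unfolding gain_eq_margin_average[OF l] num den by (simp add: acceptance_def)
qed

text \<open>
  Both gains are compared through the margin at the mean rate of the dynamic policy: the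
  dynamic one is at most that margin times \<open>1 - P\<^sub>m\<close>, the static one equals it times the
  Erlang acceptance probability.
\<close>
lemma cutoff_gain_ge_dynamic_gain:
  assumes l: "l \<in> policies Q" and gain: "0 < gain Q l" and reg: "regular Q"
    and costs: "Cost_s Q \<le> Cost_q Q" "ccdf Q (departure_cost Q (Suc (servers Q))) = 0"
  shows "15 / 19 * gain Q l \<le> gain Q (cutoff_policy (servers Q) (mean_free_rate Q l))"
proof -
  define x where "x = mean_free_rate Q l / (service_rate Q + theta_s Q)"
  define A W H where "A = free_mass Q l" and "W = (\<Sum>n\<le>servers Q. weight Q l n)"
    and "H = margin Q (mean_free_rate Q l)"
  have m: "1 \<le> servers Q" and x: "0 \<le> x"
    using mean_free_rate_range[OF l] model by (auto simp: x_def queue_model_def)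
  have pos: "0 < A" "0 < W"
    using free_mass_pos[OF l] weight_sum_pos[OF l] by (auto simp: A_def W_def)
  have "gain Q l \<le> A * H / W"
    using gain_le_loss_system_gain[OF l gain costs]
      divide_right_mono[OF margin_jensen[OF l reg], of W] pos
    by (simp add: A_def W_def H_def)
  then have le: "gain Q l \<le> H * (A / W)" by (simp add: mult.commute)
  then have H: "0 \<le> H"
    using gain pos by (smt (verit) divide_pos_pos mult_nonpos_nonneg)
  have "15 / 19 * gain Q l \<le> 15 / 19 * (H * (A / W))"
    using le by (rule mult_left_mono) simp
  also have "\<dots> = H * (15 / 19 * (A / W))" by (rule mult.left_commute)
  also have "\<dots> \<le> H * (15 / 19 * min 1 (real (servers Q) / (1 + x)))"
    using not_full_le[OF l] H by (intro mult_left_mono) (auto simp: A_def W_def x_def)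
  also have "\<dots> \<le> H * acceptance (servers Q) x"
    using acceptance_bound[OF m x] H by (intro mult_left_mono)
  also have "\<dots> = gain Q (cutoff_policy (servers Q) (mean_free_rate Q l))"
    by (simp add: gain_cutoff[OF mean_free_rate_range[OF l]] H_def x_def)
  finally show ?thesis .
qed

end

theorem proposition5p3:
  fixes Q :: queue
  assumes "queue_model Q"
    and "regular Q"
    and "ccdf Q (Cost_s Q) > 0"
    and "Cost_s Q \<le> Cost_q Q"
    and "ccdf Q (departure_rate Q (servers Q) / departure_rate Q (servers Q + 1) * Cost_s Q
          + (departure_rate Q (servers Q + 1) - departure_rate Q (servers Q))
              / departure_rate Q (servers Q + 1) * Cost_q Q) = 0"
  shows "best_cutoff_gain Q / optimal_gain Q \<ge> 15 / 19"
proof -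
  note model = assms(1) and reg = assms(2)
  have mN: "servers Q \<le> capacity Q" and m: "1 \<le> servers Q"
    using model by (auto simp: queue_model_def)
  have costly: "ccdf Q (departure_cost Q (Suc (servers Q))) = 0"
    using assms(5) departure_cost_above[OF model, of "Suc (servers Q)"] by simp
  obtain l where l: "l \<in> policies Q" "optimal_gain Q = gain Q l"
    and opt: "\<And>l'. l' \<in> policies Q \<Longrightarrow> gain Q l' \<le> gain Q l"
    using optimal_gain_attained[OF model reg] by blast
  obtain d where d: "d \<in> {0..max_rate Q}" "0 < margin Q d"
    using margin_pos_exists[OF model assms(3)] by blast
  have "0 \<le> d / (service_rate Q + theta_s Q)"
    using d model by (auto simp: queue_model_def)
  then have "0 < acceptance (servers Q) (d / (service_rate Q + theta_s Q))"
    using acceptance_bound[OF m, of "d / (service_rate Q + theta_s Q)"] m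
    by (smt (verit) divide_pos_pos min_def of_nat_1 of_nat_mono mult_pos_pos)
  then have "0 < gain Q (cutoff_policy (servers Q) d)"
    using gain_cutoff[OF model d(1)] d(2) by simp
  then have pos: "0 < gain Q l"
    using opt[OF cutoff_policy_in_policies[OF model mN d(1)]] by linarith
  have "15 / 19 * gain Q l \<le> gain Q (cutoff_policy (servers Q) (mean_free_rate Q l))"
    by (rule cutoff_gain_ge_dynamic_gain[OF model l(1) pos reg assms(4) costly])
  also have "\<dots> \<le> best_cutoff_gain Q"
    by (rule cutoff_gain_le_best[OF model reg mN mean_free_rate_range[OF model l(1)]])
  finally show ?thesis using pos by (simp add: l(2) le_divide_eq)
qed

end
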